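(* Let $\mu$ be a finite Borel measure on $\mathbb{R}^d$ such that $\lim_{|\xi|\to\infty}\widehat\mu(\xi)=0$, and let $A\in\mathbb{R}^{d\times d}$ be an invertible matrix such that $|\lambda|\neq 1$ for all (complex) eigenvalues $\lambda$ of $A$. Then $$\dim_{\mathrm{F}}(\mu+A\mu)=\dim_{\mathrm{F}}\mu.$$
   Context: $A\mu$ denotes the image (push-forward) of $\mu$ under the linear map $x\mapsto Ax$. For a finite Borel measure $\mu$ on $\mathbb{R}^d$, $\widehat\mu(\xi)=\int e^{-2\pi i \xi\cdot x}\,d\mu(x)$ for $\xi\in\mathbb{R}^d$. The notation $f(\xi)\lesssim g(\xi)$ means there is a constant $C$ with $|f(\xi)|\le C|g(\xi)|$ for all $\xi$ (negative powers of $|\xi|$ are read as $+\infty$ at $\xi=0$). The Fourier dimension of $\mu$ is $\dim_{\mathrm{F}}\mu=\sup\{s\in[0,d]:\ \widehat\mu(\xi)\lesssim|\xi|^{-s/2}\}$. *)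

theory Defs
  imports "HOL-Analysis.Analysis"
begin

definition add_measure :: "'a measure \<Rightarrow> 'a measure \<Rightarrow> 'a measure" where
  "add_measure M N = measure_of (space M) (sets M) (\<lambda>X. emeasure M X + emeasure N X)"

lemma space_add_measure [simp]: "space (add_measure M N) = space M"
  and sets_add_measure [simp, measurable_cong]: "sets (add_measure M N) = sets M"
  by (simp_all add: add_measure_def)

(* measure_of silently yields the null measure unless its argument is countably additive;
   the next lemma rules this out. *)
lemma emeasure_add_measure:
  assumes "sets N = sets M" and "X \<in> sets M"
  shows "emeasure (add_measure M N) X = emeasure M X + emeasure N X"
proof (rule emeasure_measure_of [OF add_measure_def])
  show "sets M \<subseteq> Pow (space M)"
    by (rule sets.space_closed)
  show "X \<in> sets (add_measure M N)"
    using assms by simp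
  show "positive (sets (add_measure M N)) (\<lambda>X. emeasure M X + emeasure N X)"
    by (simp add: positive_def)
  show "countably_additive (sets (add_measure M N)) (\<lambda>X. emeasure M X + emeasure N X)"
  proof (rule countably_additiveI)
    fix F :: "nat \<Rightarrow> 'a set"
    assume F: "range F \<subseteq> sets (add_measure M N)" "disjoint_family F"
    have "(\<Sum>i. emeasure M (F i) + emeasure N (F i))
        = (\<Sum>i. emeasure M (F i)) + (\<Sum>i. emeasure N (F i))"
      by (rule suminf_add [symmetric]) auto
    also have "\<dots> = emeasure M (\<Union>i. F i) + emeasure N (\<Union>i. F i)"
      using F assms(1) by (simp add: suminf_emeasure)
    finally show "(\<Sum>i. emeasure M (F i) + emeasure N (F i))
        = emeasure M (\<Union>i. F i) + emeasure N (\<Union>i. F i)" .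
  qed
qed

definition push_forward :: "real ^ 'd ^ 'd \<Rightarrow> (real ^ 'd) measure \<Rightarrow> (real ^ 'd) measure" where
  "push_forward A M = distr M borel (\<lambda>x. A *v x)"

definition fourier_transform :: "(real ^ 'd) measure \<Rightarrow> real ^ 'd \<Rightarrow> complex" where
  "fourier_transform M \<xi> =
     (LINT x|M. exp (- 2 * of_real pi * \<i> * of_real (\<xi> \<bullet> x)))"

(* The frequency 0 is left out: for s > 0 the right-hand side is read as infinity there, and
   for s = 0, where it equals C, the bound at 0 can be met by enlarging C. (In the library,
   0 powr a = 0 for every a, so including 0 would be wrong.) *)
definition fourier_dim :: "(real ^ 'd) measure \<Rightarrow> real" where
  "fourier_dim M = Sup {s \<in> {0..real CARD('d)}.
     \<exists>C. \<forall>\<xi>. \<xi> \<noteq> 0 \<longrightarrow> norm (fourier_transform M \<xi>) \<le> C * norm \<xi> powr (- s / 2)}"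

definition complex_eigenvalue :: "real ^ 'd ^ 'd \<Rightarrow> complex \<Rightarrow> bool" where
  "complex_eigenvalue A z \<longleftrightarrow>
     (\<exists>v :: complex ^ 'd. v \<noteq> 0 \<and> map_matrix complex_of_real A *v v = z *s v)"

end

theory Submission
  imports Defs "HOL-Computational_Algebra.Fundamental_Theorem_Algebra"
begin

text \<open>
  Put B = transpose A, f = the transform of \<open>\<mu>\<close> and g = f + f \<open>\<circ>\<close> B, which is the transform of
  \<open>\<mu> + A\<mu>\<close>. A decay bound for f clearly passes to g. Conversely, by hyperbolicity of B, every
  frequency has a forward or a backward orbit under B whose norm grows geometrically, with uniform
  constants. Telescoping f = g - f \<open>\<circ>\<close> B along that orbit bounds f by a geometric series of values
  of g; the remainder vanishes because f tends to 0 at infinity.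

  The growth of orbits is obtained without splitting the space into invariant subspaces. A product
  of factors \<open>B - z\<^sub>i\<close> over eigenvalues vanishes, and the partial products
  \<open>X\<^sub>k = (B - z\<^sub>k) \<dots> (B - z\<^sub>1) x\<close> satisfy \<open>B X\<^sub>k = z\<^sub>k\<^sub>+\<^sub>1 X\<^sub>k + X\<^sub>k\<^sub>+\<^sub>1\<close>, so in these redundant coordinates
  B is bidiagonal. Rescaling makes the off-diagonal part small, and the cone where the expanding
  coordinates dominate is then invariant.
\<close>

section \<open>Integrals and Fourier transforms of sums and images of measures\<close>

text \<open>Measure-theoretic induction, run twice. The nonnegative case \<open>nn\<close> shows
  that integrability for the sum is integrability for both summands; this lets the second induction
  pass from indicators through sums to dominated limits.\<close>

lemma integral_add_measure:
  fixes f :: "'a \<Rightarrow> 'b::{banach, second_countable_topology}"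
  assumes sets: "sets N = sets M" and "integrable M f" "integrable N f"
  shows "(LINT x|add_measure M N. f x) = (LINT x|M. f x) + (LINT x|N. f x)"
proof -
  have em: "emeasure (add_measure M N) X = emeasure M X + emeasure N X" if "X \<in> sets M" for X
    using emeasure_add_measure[OF sets that] .
  have meas [measurable_cong]: "sets N = sets M" by (rule sets)
  have nn: "(\<integral>\<^sup>+x. u x \<partial>add_measure M N) = (\<integral>\<^sup>+x. u x \<partial>M) + (\<integral>\<^sup>+x. u x \<partial>N)"
    if "u \<in> borel_measurable M" for u
    using that
  proof (induction rule: borel_measurable_induct)
    case (cong f g)
    have "integral\<^sup>N L f = integral\<^sup>N L g" if "space L = space M" for L
      using cong(3) that by (intro nn_integral_cong) simp
    then show ?case
      using cong(4) sets_eq_imp_space_eq[OF sets] by simp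
  next
    case (set A)
    then show ?case
      using sets by (simp add: em)
  next
    case (mult u c)
    then show ?case
      by (simp add: nn_integral_cmult distrib_left measurable_cong_sets[OF sets])
  next
    case (add u v)
    then show ?case
      by (simp add: nn_integral_add measurable_cong_sets[OF sets] ac_simps)
  next
    case (seq U)
    then have [measurable]: "\<And>i. U i \<in> borel_measurable M" by simp
    have mono: "incseq (\<lambda>i. integral\<^sup>N L (U i))" for L :: "'a measure"
      using seq(3) by (auto simp: incseq_def le_fun_def intro!: nn_integral_mono)
    have "(\<integral>\<^sup>+x. (SUP i. U i) x \<partial>add_measure M N) = (SUP i. integral\<^sup>N (add_measure M N) (U i))"
      unfolding SUP_apply using seq(3) by (intro nn_integral_monotone_convergence_SUP) auto
    also have "\<dots> = (SUP i. integral\<^sup>N M (U i) + integral\<^sup>N N (U i))"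
      using seq by simp
    also have "\<dots> = (SUP i. integral\<^sup>N M (U i)) + (SUP i. integral\<^sup>N N (U i))"
      by (intro ennreal_SUP_add mono)
    also have "\<dots> = (\<integral>\<^sup>+x. (SUP i. U i) x \<partial>M) + (\<integral>\<^sup>+x. (SUP i. U i) x \<partial>N)"
      unfolding SUP_apply using seq(3)
      by (subst (1 2) nn_integral_monotone_convergence_SUP) auto
    finally show ?case .
  qed
  have iff: "integrable (add_measure M N) h \<longleftrightarrow> integrable M h \<and> integrable N h" for h :: "'a \<Rightarrow> 'b"
    by (auto simp: integrable_iff_bounded nn measurable_cong_sets[OF sets])
  have "integrable (add_measure M N) f"
    using assms by (simp add: iff)
  then show ?thesis
  proof (induction rule: integrable_induct)
    case (base A c)
    then have "A \<in> sets M" "emeasure M A < \<infinity>" "emeasure N A < \<infinity>"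
      by (auto simp: em)
    then show ?case
      by (simp add: measure_def em enn2real_plus scaleR_add_left meas)
  next
    case (add f g)
    then show ?case
      by (simp add: iff)
  next
    case (lim f s)
    have f: "integrable M f" "integrable N f"
      using lim(4) by (auto simp: iff)
    have s: "integrable M (s i)" "integrable N (s i)" for i
      using lim(1) by (auto simp: iff)
    \<comment> \<open>Stated for an arbitrary \<open>L\<close>, because dominated convergence is
      used for both summands and for their sum.\<close>
    have *: "(\<lambda>i. integral\<^sup>L L (s i)) \<longlonglongrightarrow> integral\<^sup>L L f"
      if "sets L = sets M" "integrable L f" "\<And>i. integrable L (s i)" for L
    proof (rule integral_dominated_convergence[where w = "\<lambda>x. 2 * norm (f x)"])
      show "AE x in L. (\<lambda>i. s i x) \<longlonglongrightarrow> f x" "\<And>i. AE x in L. norm (s i x) \<le> 2 * norm (f x)"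
        using lim(2,3) sets_eq_imp_space_eq[OF that(1)] by auto
    qed (use that in auto)
    have "(\<lambda>i. integral\<^sup>L M (s i) + integral\<^sup>L N (s i)) \<longlonglongrightarrow> integral\<^sup>L M f + integral\<^sup>L N f"
      by (intro tendsto_add *) (use f s sets in auto)
    moreover have "(\<lambda>i. integral\<^sup>L (add_measure M N) (s i)) \<longlonglongrightarrow> integral\<^sup>L (add_measure M N) f"
      by (intro *) (use lim(1,4) in auto)
    ultimately show ?case
      using lim(5) LIMSEQ_unique by simp
  qed
qed

lemma fourier_integrable:
  fixes M :: "(real ^ 'd) measure"
  assumes "finite_measure M" "sets M = sets borel"
  shows "integrable M (\<lambda>x. exp (- 2 * of_real pi * \<i> * of_real (\<xi> \<bullet> x)))"
proof (rule finite_measure.integrable_const_bound[OF assms(1), where B = 1])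
  show "(\<lambda>x. exp (- 2 * of_real pi * \<i> * of_real (\<xi> \<bullet> x))) \<in> borel_measurable M"
    unfolding measurable_cong_sets[OF assms(2) refl]
    by (intro borel_measurable_continuous_onI continuous_intros)
qed simp

lemma norm_fourier_transform_le:
  fixes M :: "(real ^ 'd) measure"
  assumes "finite_measure M" "sets M = sets borel"
  shows "norm (fourier_transform M \<xi>) \<le> measure M (space M)"
proof -
  have "norm (fourier_transform M \<xi>)
      \<le> (LINT x|M. norm (exp (- 2 * of_real pi * \<i> * of_real (\<xi> \<bullet> x))))"
    unfolding fourier_transform_def by (rule integral_norm_bound)
  also have "\<dots> = measure M (space M)"
    by simp
  finally show ?thesis .
qed

lemma finite_measure_push_forward:
  assumes "finite_measure M" "sets M = sets borel"
  shows "finite_measure (push_forward A M)"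
  unfolding push_forward_def
proof (rule finite_measure.finite_measure_distr[OF assms(1)])
  show "(*v) A \<in> M \<rightarrow>\<^sub>M borel"
    unfolding measurable_cong_sets[OF assms(2) refl]
    by (intro borel_measurable_continuous_onI matrix_vector_mult_linear_continuous_on)
qed

lemma sets_push_forward [simp]: "sets (push_forward A M) = sets borel"
  by (simp add: push_forward_def)

text \<open>Change of variables, and moving \<open>A\<close> to the other side of the inner product.
  This is why the dynamics on frequencies is that of the transpose.\<close>

lemma fourier_transform_push_forward:
  fixes M :: "(real ^ 'd) measure"
  assumes "sets M = sets borel"
  shows "fourier_transform (push_forward A M) \<xi> = fourier_transform M (transpose A *v \<xi>)"
proof -
  have "(*v) A \<in> M \<rightarrow>\<^sub>M borel"
    unfolding measurable_cong_sets[OF assms refl]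
    by (intro borel_measurable_continuous_onI matrix_vector_mult_linear_continuous_on)
  moreover have "(\<lambda>x. exp (- 2 * of_real pi * \<i> * of_real (\<xi> \<bullet> x))) \<in> borel_measurable borel"
    by (intro borel_measurable_continuous_onI continuous_intros)
  ultimately show ?thesis
    unfolding fourier_transform_def push_forward_def
    by (simp add: integral_distr dot_lmul_matrix flip: vector_transpose_matrix)
qed

lemma fourier_transform_add_push_forward:
  fixes M :: "(real ^ 'd) measure"
  assumes "finite_measure M" "sets M = sets borel"
  shows "fourier_transform (add_measure M (push_forward A M)) \<xi>
       = fourier_transform M \<xi> + fourier_transform M (transpose A *v \<xi>)"
proof -
  have "fourier_transform (add_measure M (push_forward A M)) \<xi>
      = fourier_transform M \<xi> + fourier_transform (push_forward A M) \<xi>"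
    unfolding fourier_transform_def
    using assms by (intro integral_add_measure fourier_integrable finite_measure_push_forward) auto
  then show ?thesis
    using assms by (simp add: fourier_transform_push_forward)
qed

section \<open>Growth of orbits from an invariant cone\<close>

text \<open>U and S measure the expanding and the contracting coordinates; the cone S \<open>\<le>\<close> U is mapped into itself.\<close>
lemma cone_dichotomy:
  fixes B :: "'a::real_normed_vector \<Rightarrow> 'a" and U S :: "'a \<Rightarrow> real"
  assumes \<delta>: "0 < \<delta>" "\<delta> \<le> 1 / 8" and K: "0 < K"
    and nonneg: "\<And>x. 0 \<le> U x" "\<And>x. 0 \<le> S x"
    and U: "\<And>x. (1 + 4 * \<delta>) * U x - \<delta> * (U x + S x) \<le> U (B x)"
    and S: "\<And>x. S (B x) \<le> (1 - 4 * \<delta>) * S x + \<delta> * (U x + S x)"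
    and norm: "\<And>x. norm x \<le> U x + S x" "\<And>x. U x + S x \<le> K * norm x"
  obtains c r where "0 < c" "1 < r"
    "\<And>x. (\<forall>n. c * r ^ n * norm x \<le> norm ((B ^^ n) x))
        \<or> (\<forall>n y. (B ^^ n) y = x \<longrightarrow> c * r ^ n * norm x \<le> norm y)"
proof -
  \<comment> \<open>Inside the cone, \<open>\<delta> * (U x + S x)\<close> is at most
    \<open>2 * \<delta> * U x\<close>, so the rate \<open>1 + 4 * \<delta>\<close> drops to
    \<open>1 + 2 * \<delta>\<close>.\<close>
  define r where "r = 1 + 2 * \<delta>"
  have r: "1 < r" and r0: "0 \<le> r"
    using \<delta> by (auto simp: r_def)
  have up: "r * U x \<le> U (B x)" "S (B x) \<le> (1 - 2 * \<delta>) * U x" if "S x \<le> U x" for x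
  proof -
    have 1: "\<delta> * S x \<le> \<delta> * U x" "(1 - 4 * \<delta>) * S x \<le> (1 - 4 * \<delta>) * U x"
      using that \<delta> by (intro mult_left_mono; simp)+
    show "r * U x \<le> U (B x)" "S (B x) \<le> (1 - 2 * \<delta>) * U x"
      using 1 U[of x] S[of x] by (simp_all add: algebra_simps r_def)
  qed
  have fwd: "r ^ n * U x \<le> U ((B ^^ n) x) \<and> S ((B ^^ n) x) \<le> U ((B ^^ n) x)"
    if "S x \<le> U x" for x n
  proof (induction n)
    case 0
    then show ?case using that by simp
  next
    case (Suc n)
    let ?y = "(B ^^ n) x"
    have 1: "r * (r ^ n * U x) \<le> r * U ?y"
      using Suc r0 by (intro mult_left_mono) auto
    have 2: "(1 - 2 * \<delta>) * U ?y \<le> r * U ?y"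
      using \<delta> nonneg by (intro mult_right_mono) (auto simp: r_def)
    show ?case
      using up[of ?y] Suc 1 2 by (auto simp: algebra_simps)
  qed
  \<comment> \<open>The reverse direction: a point strictly inside the cone would have an image
    strictly inside it, so preimages stay in the region U \<le> S. There S contracts by
    \<open>1 - 2 * \<delta>\<close>, and
    \<open>r * (1 - 2 * \<delta>) = 1 - (2 * \<delta>)\<^sup>2\<close> is at most 1.\<close>
  have step: "U y \<le> S y \<and> r * S (B y) \<le> S y" if le: "U (B y) \<le> S (B y)" for y
  proof -
    have "U y \<le> S y"
    proof (rule ccontr)
      assume "\<not> U y \<le> S y"
      moreover from this have "0 < \<delta> * U y"
        using \<delta> nonneg(2)[of y] by (intro mult_pos_pos) auto
      ultimately show False
        using up[of y] le by (simp add: algebra_simps r_def)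
    qed
    then have "\<delta> * U y \<le> \<delta> * S y"
      using \<delta> by (intro mult_left_mono) auto
    then have "S (B y) \<le> (1 - 2 * \<delta>) * S y"
      using S[of y] by (simp add: algebra_simps)
    then have "r * S (B y) \<le> r * ((1 - 2 * \<delta>) * S y)"
      using r0 by (rule mult_left_mono)
    also have "\<dots> = S y - (2 * \<delta>)\<^sup>2 * S y"
      by (simp add: r_def algebra_simps power2_eq_square)
    also have "\<dots> \<le> S y"
      using nonneg by simp
    finally show ?thesis
      using \<open>U y \<le> S y\<close> by simp
  qed
  \<comment> \<open>Backward orbits are expressed through n-th preimages \<open>y\<close>; the
    induction peels off the innermost application of \<open>B\<close>, so \<open>y\<close> is
    generalised.\<close>
  have bwd: "U y \<le> S y \<and> r ^ n * S ((B ^^ n) y) \<le> S y" if "U ((B ^^ n) y) \<le> S ((B ^^ n) y)" for y n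
    using that
  proof (induction n arbitrary: y)
    case 0
    then show ?case by simp
  next
    case (Suc n)
    let ?x = "(B ^^ n) (B y)"
    have IH: "U (B y) \<le> S (B y)" "r ^ n * S ?x \<le> S (B y)"
      using Suc.IH[of "B y"] Suc.prems by (simp_all add: funpow_swap1)
    have "r * (r ^ n * S ?x) \<le> r * S (B y)"
      using IH(2) r0 by (rule mult_left_mono)
    then show ?case
      using step[OF IH(1)] by (simp add: funpow_swap1 mult.assoc)
  qed
  \<comment> \<open>In the constant, 2 comes from bounding \<open>U x + S x\<close> by twice the
    dominant term, and \<open>K\<close> from returning from U or S to the norm.\<close>
  have dich: "(\<forall>n. 1 / (2 * K) * r ^ n * norm x \<le> norm ((B ^^ n) x))
        \<or> (\<forall>n y. (B ^^ n) y = x \<longrightarrow> 1 / (2 * K) * r ^ n * norm x \<le> norm y)" for x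
  proof (cases "S x \<le> U x")
    case True
    have "1 / (2 * K) * r ^ n * norm x \<le> norm ((B ^^ n) x)" for n
    proof -
      have "r ^ n * norm x \<le> r ^ n * (2 * U x)"
        using norm(1)[of x] True r0 by (intro mult_left_mono) auto
      also have "\<dots> \<le> 2 * U ((B ^^ n) x)"
        using fwd[OF True, of n] by simp
      also have "\<dots> \<le> 2 * (K * norm ((B ^^ n) x))"
        using norm(2)[of "(B ^^ n) x"] nonneg(2)[of "(B ^^ n) x"] by simp
      finally show ?thesis
        using K by (simp add: field_simps)
    qed
    then show ?thesis by simp
  next
    case False
    have "1 / (2 * K) * r ^ n * norm x \<le> norm y" if x: "(B ^^ n) y = x" for n y
    proof -
      have "r ^ n * norm x \<le> r ^ n * (2 * S x)"
        using norm(1)[of x] False r0 by (intro mult_left_mono) auto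
      also have "\<dots> \<le> 2 * S y"
        using bwd[of n y] False x by simp
      also have "\<dots> \<le> 2 * (K * norm y)"
        using norm(2)[of y] nonneg(1)[of y] by simp
      finally show ?thesis
        using K by (simp add: field_simps)
    qed
    then show ?thesis by simp
  qed
  show thesis
    by (rule that[of "1 / (2 * K)" r]) (use K r dich in auto)
qed

text \<open>The weights \<open>(1 / \<delta>) ^ k\<close> in the proof turn the superdiagonal entries 1 into \<open>\<delta>\<close>.\<close>
lemma bidiagonal_dichotomy:
  fixes B :: "'a::real_normed_vector \<Rightarrow> 'a" and a :: "nat \<Rightarrow> 'a \<Rightarrow> real" and l :: "nat \<Rightarrow> real"
  assumes nonneg: "\<And>k x. 0 \<le> a k x" and aN: "\<And>x. a N x = 0"
    and l: "\<And>k. k < N \<Longrightarrow> 0 \<le> l k" "\<And>k. k < N \<Longrightarrow> l k \<noteq> 1"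
    and step: "\<And>k x. k < N \<Longrightarrow> \<bar>a k (B x) - l k * a k x\<bar> \<le> a (Suc k) x"
    and norm: "\<And>x. norm x \<le> a 0 x" "\<And>k x. k < N \<Longrightarrow> a k x \<le> D k * norm x"
  obtains c r where "0 < c" "1 < r"
    "\<And>x. (\<forall>n. c * r ^ n * norm x \<le> norm ((B ^^ n) x))
        \<or> (\<forall>n y. (B ^^ n) y = x \<longrightarrow> c * r ^ n * norm x \<le> norm y)"
proof -
  \<comment> \<open>The spectral gap. Inserting 1 keeps the set nonempty when \<open>N = 0\<close>
    and gives \<open>e \<le> 1\<close>, hence \<open>\<delta> \<le> 1 / 8\<close> below; moreover
    \<open>4 * \<delta>\<close> stays below every gap.\<close>
  define e where "e = Min (insert 1 ((\<lambda>k. \<bar>l k - 1\<bar>) ` {..<N}))"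
  have e: "0 < e" "e \<le> 1"
    using l(2) by (auto simp: e_def)
  have el: "e \<le> \<bar>l k - 1\<bar>" if "k < N" for k
    using that by (auto simp: e_def)
  define \<delta> where "\<delta> = e / 8"
  have \<delta>: "0 < \<delta>" "\<delta> \<le> 1 / 8"
    using e by (auto simp: \<delta>_def)
  define b where "b k x = (1 / \<delta>) ^ k * a k x" for k x
  have b0: "0 \<le> b k x" for k x
    using \<delta> nonneg by (simp add: b_def)
  have bstep: "\<bar>b k (B x) - l k * b k x\<bar> \<le> \<delta> * b (Suc k) x" if "k < N" for k x
  proof -
    have "b k (B x) - l k * b k x = (1 / \<delta>) ^ k * (a k (B x) - l k * a k x)"
      by (simp add: b_def algebra_simps)
    then have "\<bar>b k (B x) - l k * b k x\<bar> = (1 / \<delta>) ^ k * \<bar>a k (B x) - l k * a k x\<bar>"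
      using \<delta> by (simp add: abs_mult)
    also have "\<dots> \<le> (1 / \<delta>) ^ k * a (Suc k) x"
      using step[OF that] \<delta> by (intro mult_left_mono) auto
    also have "\<dots> = \<delta> * b (Suc k) x"
      using \<delta> by (simp add: b_def)
    finally show ?thesis .
  qed
  define P where "P = {k. k < N \<and> 1 < l k}"
  define Q where "Q = {k. k < N \<and> l k < 1}"
  have fin: "finite P" "finite Q" and PQ: "P \<inter> Q = {}" "P \<union> Q = {..<N}"
    using l(2) by (force simp: P_def Q_def)+
  define U where "U x = (\<Sum>k\<in>P. b k x)" for x
  define S where "S x = (\<Sum>k\<in>Q. b k x)" for x
  have US: "U x + S x = (\<Sum>k<N. b k x)" for x
    using sum.union_disjoint[OF fin PQ(1), of "\<lambda>k. b k x"] PQ(2) by (simp add: U_def S_def)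
  \<comment> \<open>The shifted indices reach \<open>N\<close>, where \<open>aN\<close> makes the
    term vanish, so all off-diagonal terms together are controlled by
    \<open>U x + S x\<close>.\<close>
  have tail: "(\<Sum>k\<in>R. b (Suc k) x) \<le> U x + S x" if "R \<subseteq> {..<N}" for R x
  proof -
    have "(\<Sum>k\<in>R. b (Suc k) x) \<le> (\<Sum>k<N. b (Suc k) x)"
      using that b0 by (intro sum_mono2) auto
    also have "\<dots> \<le> (\<Sum>k<Suc N. b k x)"
      using b0 by (simp only: sum.lessThan_Suc_shift) simp
    also have "\<dots> = U x + S x"
      using aN by (simp add: US b_def)
    finally show ?thesis .
  qed
  show thesis
  \<comment> \<open>The leading 1 keeps the constant positive even if the sum is 0; absolute values
    are taken because \<open>D k\<close> may be negative.\<close>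
  proof (rule cone_dichotomy[of \<delta> "1 + (\<Sum>k<N. (1 / \<delta>) ^ k * \<bar>D k\<bar>)" U S B])
    show "0 < \<delta>" "\<delta> \<le> 1 / 8" by (fact \<delta>)+
    have "0 \<le> (\<Sum>k<N. (1 / \<delta>) ^ k * \<bar>D k\<bar>)"
      using \<delta> by (intro sum_nonneg) auto
    then show "0 < 1 + (\<Sum>k<N. (1 / \<delta>) ^ k * \<bar>D k\<bar>)" by simp
    show "0 \<le> U x" "0 \<le> S x" for x
      using b0 by (auto simp: U_def S_def intro: sum_nonneg)
    show "(1 + 4 * \<delta>) * U x - \<delta> * (U x + S x) \<le> U (B x)" for x
    proof -
      have "(1 + 4 * \<delta>) * b k x - \<delta> * b (Suc k) x \<le> b k (B x)" if "k \<in> P" for k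
      proof -
        have "(1 + 4 * \<delta>) * b k x \<le> l k * b k x"
          using that el[of k] e b0 by (intro mult_right_mono) (auto simp: P_def \<delta>_def)
        then show ?thesis
          using bstep[of k x] that by (auto simp: P_def)
      qed
      then have "(\<Sum>k\<in>P. (1 + 4 * \<delta>) * b k x - \<delta> * b (Suc k) x) \<le> U (B x)"
        unfolding U_def by (intro sum_mono)
      moreover have "\<delta> * (\<Sum>k\<in>P. b (Suc k) x) \<le> \<delta> * (U x + S x)"
        using tail[of P x] PQ \<delta> by (intro mult_left_mono) auto
      ultimately show ?thesis
        by (simp add: U_def sum_subtractf sum_distrib_left)
    qed
    show "S (B x) \<le> (1 - 4 * \<delta>) * S x + \<delta> * (U x + S x)" for x
    proof -
      have "b k (B x) \<le> (1 - 4 * \<delta>) * b k x + \<delta> * b (Suc k) x" if "k \<in> Q" for k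
      proof -
        have "l k * b k x \<le> (1 - 4 * \<delta>) * b k x"
          using that el[of k] e b0 by (intro mult_right_mono) (auto simp: Q_def \<delta>_def)
        then show ?thesis
          using bstep[of k x] that by (auto simp: Q_def)
      qed
      then have "S (B x) \<le> (\<Sum>k\<in>Q. (1 - 4 * \<delta>) * b k x + \<delta> * b (Suc k) x)"
        unfolding S_def by (intro sum_mono)
      moreover have "\<delta> * (\<Sum>k\<in>Q. b (Suc k) x) \<le> \<delta> * (U x + S x)"
        using tail[of Q x] PQ \<delta> by (intro mult_left_mono) auto
      ultimately show ?thesis
        by (simp add: S_def sum.distrib sum_distrib_left)
    qed
    show "norm x \<le> U x + S x" for x
    \<comment> \<open>For \<open>N = 0\<close> the sum is empty, but then \<open>aN\<close> speaks
      of index 0 and forces \<open>norm x = 0\<close>.\<close>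
    proof (cases "N = 0")
      case True
      then show ?thesis
        using norm(1)[of x] aN[of x] by (simp add: US)
    next
      case False
      then have "b 0 x \<le> (\<Sum>k<N. b k x)"
        using b0 by (intro member_le_sum) auto
      then show ?thesis
        using norm(1)[of x] by (simp add: US b_def)
    qed
    show "U x + S x \<le> (1 + (\<Sum>k<N. (1 / \<delta>) ^ k * \<bar>D k\<bar>)) * norm x" for x
    proof -
      have "b k x \<le> (1 / \<delta>) ^ k * \<bar>D k\<bar> * norm x" if "k < N" for k
      proof -
        have "a k x \<le> \<bar>D k\<bar> * norm x"
          using norm(2)[OF that, of x] by (rule order_trans) (intro mult_right_mono; simp)
        then show ?thesis
          using \<delta> unfolding b_def mult.assoc by (intro mult_left_mono) auto
      qed
      then have "U x + S x \<le> (\<Sum>k<N. (1 / \<delta>) ^ k * \<bar>D k\<bar> * norm x)"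
        unfolding US by (intro sum_mono) auto
      also have "\<dots> \<le> norm x + (\<Sum>k<N. (1 / \<delta>) ^ k * \<bar>D k\<bar> * norm x)"
        by simp
      finally show ?thesis
        by (simp add: distrib_right sum_distrib_right)
    qed
  qed (rule that)
qed

section \<open>Annihilating products of eigenvalue factors\<close>

text \<open>The vectors form a family and may repeat. If they are distinct, their set is too large
  to be independent; if two indices share a vector, coefficients 1 and -1 there give the
  relation.\<close>

lemma linear_relation:
  fixes w :: "nat \<Rightarrow> 'a::euclidean_space"
  obtains c where "(\<Sum>i\<le>DIM('a). c i *\<^sub>R w i) = 0" "\<exists>i\<le>DIM('a). c i \<noteq> 0"
proof (cases "inj_on w {..DIM('a)}")
  case True
  then have "dependent (w ` {..DIM('a)})"
    by (intro dependent_biggerset) (simp add: card_image)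
  then obtain u v where u: "v \<in> w ` {..DIM('a)}" "u v \<noteq> 0"
      "(\<Sum>v\<in>w ` {..DIM('a)}. u v *\<^sub>R v) = 0"
    by (auto simp: dependent_finite)
  show thesis
    by (rule that[of "u \<circ> w"]) (use u True in \<open>auto simp: sum.reindex\<close>)
next
  case False
  then obtain i j where ij: "i \<le> DIM('a)" "j \<le> DIM('a)" "i \<noteq> j" "w i = w j"
    by (auto simp: inj_on_def)
  define c where "c k = (if k = i then 1 else if k = j then -1 else 0 :: real)" for k
  have "(\<Sum>k\<le>DIM('a). c k *\<^sub>R w k) = (\<Sum>k\<in>{i, j}. c k *\<^sub>R w k)"
    using ij by (intro sum.mono_neutral_right) (auto simp: c_def)
  also have "\<dots> = 0"
    using ij by (simp add: c_def)
  finally show thesis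
    using ij by (intro that[of c]) (auto simp: c_def)
qed

definition shift_op :: "complex ^ 'd ^ 'd \<Rightarrow> complex \<Rightarrow> complex ^ 'd \<Rightarrow> complex ^ 'd" where
  "shift_op M z v = M *v v - z *s v"

text \<open>The vector p(M) v, with p(M) treated as a map, so that a factorisation of p becomes a
  composition of maps.\<close>

definition poly_op :: "complex ^ 'd ^ 'd \<Rightarrow> complex poly \<Rightarrow> complex ^ 'd \<Rightarrow> complex ^ 'd" where
  "poly_op M p v = (\<Sum>i\<le>degree p. coeff p i *s (((*v) M ^^ i) v))"

lemma poly_op_eq:
  assumes "degree p \<le> n"
  shows "poly_op M p v = (\<Sum>i\<le>n. coeff p i *s (((*v) M ^^ i) v))"
  unfolding poly_op_def using assms
  by (intro sum.mono_neutral_left) (auto simp: coeff_eq_0)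

lemma poly_op_linear_factor:
  "poly_op M ([:-z, 1:] * q) v = shift_op M z (poly_op M q v)"
proof -
  let ?n = "degree q"
  let ?T = "\<lambda>i. ((*v) M ^^ i) v"
  have "degree ([:-z, 1:] * q) \<le> Suc ?n"
    by (rule order_trans[OF degree_mult_le]) simp
  \<comment> \<open>\<open>pCons 0 q\<close> is q times the variable: shifting its index produces
    one more application of \<open>M\<close>. In the other sum the extra top term is 0, as its index
    exceeds the degree of q.\<close>
  then have "poly_op M ([:-z, 1:] * q) v
      = (\<Sum>i\<le>Suc ?n. coeff (pCons 0 q) i *s ?T i - (z * coeff q i) *s ?T i)"
    by (subst poly_op_eq) (auto simp: vec.scale_left_diff_distrib intro!: sum.cong)
  also have "\<dots> = (\<Sum>i\<le>Suc ?n. coeff (pCons 0 q) i *s ?T i) - (\<Sum>i\<le>Suc ?n. (z * coeff q i) *s ?T i)"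
    by (rule sum_subtractf)
  also have "(\<Sum>i\<le>Suc ?n. coeff (pCons 0 q) i *s ?T i) = (\<Sum>i\<le>?n. coeff q i *s (M *v ?T i))"
    by (subst sum.atMost_Suc_shift) simp
  also have "\<dots> = M *v poly_op M q v"
    by (simp add: poly_op_def vec.linear_sum[OF matrix_vector_mul_linear_gen] vector_scalar_commute)
  also have "(\<Sum>i\<le>Suc ?n. (z * coeff q i) *s ?T i) = z *s poly_op M q v"
    by (simp add: poly_op_def vec.scale_sum_right coeff_eq_0)
  finally show ?thesis
    by (simp add: shift_op_def)
qed

lemma poly_op_prod_list:
  "poly_op M (\<Prod>z\<leftarrow>zs. [:-z, 1:]) v = foldr (shift_op M) zs v"
  by (induction zs) (simp_all only: poly_op_linear_factor list.map prod_list.Cons foldr.simps o_apply, simp add: poly_op_def)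

lemma shift_op_commute: "shift_op M y (shift_op M z v) = shift_op M z (shift_op M y v)"
  by (simp add: shift_op_def matrix_vector_mult_diff_distrib vector_scalar_commute vec.scale_right_diff_distrib
      vec.scale_left_commute algebra_simps)

lemma foldr_shift_op_commute:
  "foldr (shift_op M) zs (shift_op M z v) = shift_op M z (foldr (shift_op M) zs v)"
  by (induction zs) (simp_all add: shift_op_commute)

text \<open>The powers of \<open>M\<close> up to the real dimension of the matrix space are linearly
  dependent. The relation is a nonzero polynomial annihilating \<open>M\<close>, which splits over
  the complex numbers; its leading coefficient is cancelled at the end.\<close>

lemma annihilating_shifts:
  fixes M :: "complex ^ 'd ^ 'd"
  obtains zs where "\<And>v. foldr (shift_op M) zs v = 0"
proof -
  define W where "W i = ((**) M ^^ i) (mat 1)" for i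
  have W: "W i *v v = ((*v) M ^^ i) v" for i v
    by (induction i) (simp_all add: W_def flip: matrix_vector_mul_assoc)
  obtain c where c: "(\<Sum>i\<le>DIM(complex ^ 'd ^ 'd). c i *\<^sub>R W i) = 0"
      "\<exists>i\<le>DIM(complex ^ 'd ^ 'd). c i \<noteq> 0"
    using linear_relation .
  define n where "n = DIM(complex ^ 'd ^ 'd)"
  note c = c[folded n_def]
  define p where "p = (\<Sum>i\<le>n. monom (complex_of_real (c i)) i)"
  have coeff: "coeff p i = (if i \<le> n then of_real (c i) else 0)" for i
    by (simp add: p_def coeff_sum)
  have "p \<noteq> 0"
    using c(2) coeff by (metis coeff_0 of_real_eq_0_iff)
  have scale: "(r *\<^sub>R X) *v v = of_real r *s (X *v v)" for r and X :: "complex ^ 'd ^ 'd" and v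
    by (simp add: vec_eq_iff matrix_vector_mult_def sum_distrib_left scaleR_conv_of_real[where 'a = complex] mult.assoc)
  have p0: "poly_op M p v = 0" for v
  proof -
    have "degree p \<le> n"
      using coeff by (intro degree_le) auto
    then have "poly_op M p v = (\<Sum>i\<le>n. of_real (c i) *s (W i *v v))"
      by (simp add: poly_op_eq coeff W)
    also have "\<dots> = (\<Sum>i\<le>n. c i *\<^sub>R W i) *v v"
      by (induction n) (simp_all add: scale matrix_vector_mult_add_rdistrib)
    finally show ?thesis
      using c(1) by simp
  qed
  obtain A where A: "p = smult (lead_coeff p) (\<Prod>x\<in>#A. [:-x, 1:])"
    using alg_closed_imp_factorization[OF \<open>p \<noteq> 0\<close>] by blast
  obtain zs where "mset zs = A"
    using ex_mset by blast
  then have "(\<Prod>x\<in>#A. [:-x, 1:]) = (\<Prod>z\<leftarrow>zs. [:-z, 1:])"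
    by (metis mset_map prod_mset_prod_list)
  then have p: "p = smult (lead_coeff p) (\<Prod>z\<leftarrow>zs. [:-z, 1:])"
    using A by simp
  have smult: "poly_op M (smult k q) v = k *s poly_op M q v" if "k \<noteq> 0" for k q v
    using that by (simp add: poly_op_def vec.scale_sum_right)
  show thesis
  proof (rule that)
    fix v
    have "lead_coeff p *s foldr (shift_op M) zs v = 0"
      using p p0[of v] smult[of "lead_coeff p" "\<Prod>z\<leftarrow>zs. [:-z, 1:]" v] \<open>p \<noteq> 0\<close>
      by (simp add: poly_op_prod_list)
    then show "foldr (shift_op M) zs v = 0"
      using \<open>p \<noteq> 0\<close> by simp
  qed
qed

text \<open>Factors belonging to non-eigenvalues are injective and commute with the others, so they can be cancelled.\<close>
lemma annihilating_eigenvalues: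
  fixes M :: "complex ^ 'd ^ 'd"
  obtains zs where "\<And>v. fold (shift_op M) zs v = 0"
    and "\<And>z. z \<in> set zs \<Longrightarrow> \<exists>v. v \<noteq> 0 \<and> M *v v = z *s v"
proof -
  define eig where "eig z \<longleftrightarrow> (\<exists>v. v \<noteq> 0 \<and> M *v v = z *s v)" for z
  have filter: "foldr (shift_op M) (filter eig zs) v = 0" if "foldr (shift_op M) zs v = 0" for zs v
    using that
  proof (induction zs arbitrary: v)
    case Nil
    then show ?case by simp
  next
    case (Cons z zs)
    have z: "shift_op M z (foldr (shift_op M) zs v) = 0"
      using Cons.prems by simp
    show ?case
    proof (cases "eig z")
      case True
      \<comment> \<open>A kept factor is commuted to the innermost place and absorbed into the
        vector; hence the induction is over all \<open>v\<close>.\<close>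
      have "foldr (shift_op M) (filter eig zs) (shift_op M z v) = 0"
        by (rule Cons.IH) (simp only: foldr_shift_op_commute z)
      then show ?thesis
        using True by (simp add: foldr_shift_op_commute)
    next
      case False
      then have "foldr (shift_op M) zs v = 0"
        using z by (auto simp: eig_def shift_op_def)
      then show ?thesis
        using False Cons.IH by simp
    qed
  qed
  obtain zs where zs: "\<And>v. foldr (shift_op M) zs v = 0"
    using annihilating_shifts[of M] by blast
  show thesis
    \<comment> \<open>\<open>fold\<close> applies the head first, \<open>foldr\<close> last. With
      \<open>fold\<close>, prefixes of the list yield the partial products.\<close>
    by (rule that[of "rev (filter eig zs)"])
      (use zs filter in \<open>auto simp: eig_def simp flip: foldr_conv_fold\<close>)
qed

section \<open>Dichotomy for hyperbolic matrices\<close>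

lemma norm_vector_scalar_mult: "norm (z *s v) = norm z * norm v" for v :: "complex ^ 'd"
  by (simp add: norm_vec_def L2_set_right_distrib norm_mult)

text \<open>The coordinates are the norms of the partial products \<open>X k x\<close>. The reverse
  triangle inequality turns the relation between \<open>M *v X k x\<close>,
  \<open>zs ! k *s X k x\<close> and \<open>X (Suc k) x\<close> into the step bound of
  \<open>bidiagonal_dichotomy\<close>, with \<open>l k\<close> the modulus of an eigenvalue.\<close>

lemma hyperbolic_dichotomy:
  fixes B :: "real ^ 'd ^ 'd"
  assumes "\<And>z. complex_eigenvalue B z \<Longrightarrow> norm z \<noteq> 1"
  obtains c r where "0 < c" "1 < r"
    "\<And>x. (\<forall>n. c * r ^ n * norm x \<le> norm (((*v) B ^^ n) x))
        \<or> (\<forall>n y. ((*v) B ^^ n) y = x \<longrightarrow> c * r ^ n * norm x \<le> norm y)"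
proof -
  define M where "M = map_matrix complex_of_real B"
  \<comment> \<open>Complexification: an isometric embedding intertwining \<open>B\<close> and
    \<open>M\<close>.\<close>
  define cv where "cv x = (\<chi> i. complex_of_real (x $ i))" for x :: "real ^ 'd"
  have cv: "M *v cv x = cv (B *v x)" for x
    by (simp add: vec_eq_iff M_def cv_def matrix_vector_mult_def)
  have norm_cv: "norm (cv x) = norm x" for x
    by (simp add: norm_vec_def cv_def)
  have linear_cv: "linear cv"
    by (rule linearI) (simp_all add: vec_eq_iff cv_def scaleR_conv_of_real[where 'a = complex])
  obtain zs where zs: "\<And>v. fold (shift_op M) zs v = 0"
      "\<And>z. z \<in> set zs \<Longrightarrow> \<exists>v. v \<noteq> 0 \<and> M *v v = z *s v"
    using annihilating_eigenvalues[of M] by blast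
  define N where "N = length zs"
  define X where "X k x = fold (shift_op M) (take k zs) (cv x)" for k x
  have X_Suc: "X (Suc k) x = shift_op M (zs ! k) (X k x)" if "k < N" for k x
    using that by (simp add: X_def N_def take_Suc_conv_app_nth)
  \<comment> \<open>\<open>shift_op M 0\<close> is multiplication by \<open>M\<close>, so this is
    the case z = 0 of the commutation of factors.\<close>
  have commute: "fold (shift_op M) ys (M *v v) = M *v fold (shift_op M) ys v" for ys v
    using foldr_shift_op_commute[of M "rev ys" 0 v] by (simp add: shift_op_def foldr_conv_fold)
  have X_B: "X k (B *v x) = M *v X k x" for k x
    by (simp add: X_def commute flip: cv)
  have linear_shift: "linear (shift_op M z)" for z
    by (rule linearI) (simp_all add: vec_eq_iff shift_op_def matrix_vector_mult_def
        sum.distrib scaleR_sum_right algebra_simps)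
  have "linear (X k)" for k
  proof -
    have "linear (fold (shift_op M) ys)" for ys
      by (induction ys) (simp_all only: fold.simps linear_compose linear_shift linear_id)
    from linear_compose[OF linear_cv this] show ?thesis
      by (simp add: X_def[abs_def] o_def)
  qed
  then have "\<exists>D. \<forall>x. norm (X k x) \<le> D * norm x" for k
    using linear_bounded by blast
  then obtain D where D: "\<And>k x. norm (X k x) \<le> D k * norm x"
    by metis
  show thesis
  proof (rule bidiagonal_dichotomy[of "\<lambda>k x. norm (X k x)" N "\<lambda>k. norm (zs ! k)" "(*v) B" D])
    show "norm (X N x) = 0" for x
      using zs(1) by (simp add: X_def N_def)
    show "norm (zs ! k) \<noteq> 1" if "k < N" for k
      using that zs(2)[of "zs ! k"] assms[of "zs ! k"]
      by (auto simp: N_def complex_eigenvalue_def M_def)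
    show "\<bar>norm (X k (B *v x)) - norm (zs ! k) * norm (X k x)\<bar> \<le> norm (X (Suc k) x)"
      if "k < N" for k x
      using norm_triangle_ineq3[of "M *v X k x" "zs ! k *s X k x"]
      by (simp add: X_Suc[OF that] X_B shift_op_def norm_vector_scalar_mult)
  qed (use D norm_cv in \<open>auto simp: X_def intro: that\<close>)
qed

text \<open>Eigenvalues are the z for which \<open>M - z\<close> has no left inverse. For square
  matrices left and right inverses coincide, and transposition exchanges them.\<close>

lemma complex_eigenvalue_transpose:
  assumes "complex_eigenvalue (transpose A) z"
  shows "complex_eigenvalue A z"
proof -
  define N where "N = map_matrix complex_of_real A - mat z"
  have mat: "mat z *v v = z *s v" for v :: "complex ^ 'a"
    by (simp add: vec_eq_iff matrix_vector_mult_def mat_def if_distrib[of "\<lambda>x. x * _"] cong: if_cong)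
  have N: "N *v v = map_matrix complex_of_real A *v v - z *s v" for v
    by (simp add: N_def matrix_vector_mult_diff_rdistrib mat)
  have Nt: "transpose N = map_matrix complex_of_real (transpose A) - mat z"
    by (simp add: N_def vec_eq_iff transpose_def map_matrix_def mat_def)
  have "\<exists>v. v \<noteq> 0 \<and> transpose N *v v = 0"
    using assms by (auto simp: complex_eigenvalue_def Nt matrix_vector_mult_diff_rdistrib mat)
  then have "\<not> (\<exists>C. C ** transpose N = mat 1)"
    unfolding matrix_left_invertible_ker by blast
  then have "\<not> (\<exists>C. C ** N = mat 1)"
    by (metis left_invertible_transpose matrix_left_right_inverse)
  then show ?thesis
    unfolding matrix_left_invertible_ker by (auto simp: N complex_eigenvalue_def)
qed

section \<open>Telescoping along a growing orbit\<close>

lemma geometric_telescope: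
  fixes a :: "nat \<Rightarrow> real"
  assumes step: "\<And>k. a k \<le> K * q ^ k + a (Suc k)" and lim: "a \<longlonglongrightarrow> 0"
    and q: "0 \<le> q" "q < 1"
  shows "a 0 \<le> K / (1 - q)"
proof -
  have partial: "a 0 \<le> (\<Sum>k<n. K * q ^ k) + a n" for n
  proof (induction n)
    case (Suc n)
    then show ?case using step[of n] by simp
  qed simp
  have "(\<lambda>k. K * q ^ k) sums (K * (1 / (1 - q)))"
    using q by (intro sums_mult geometric_sums) simp
  then have "(\<lambda>n. (\<Sum>k<n. K * q ^ k) + a n) \<longlonglongrightarrow> K * (1 / (1 - q)) + 0"
    unfolding sums_def using lim by (rule tendsto_add)
  then have "a 0 \<le> K * (1 / (1 - q)) + 0"
    by (rule LIMSEQ_le_const) (use partial in blast)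
  then show ?thesis
    by simp
qed

text \<open>Growth of \<open>w\<close> makes the values of g geometric with ratio
  \<open>r powr (- p)\<close>, which is below 1 as p > 0; growth of \<open>z\<close> makes the
  remainder vanish. Two sequences are used because g is evaluated at the current point of a forward
  orbit but at the next point of a backward one.\<close>

lemma decay_along_orbit:
  fixes f :: "'a::real_normed_vector \<Rightarrow> complex" and z w :: "nat \<Rightarrow> 'a" and x :: 'a
  assumes lim: "(f \<longlongrightarrow> 0) at_infinity"
    and g: "\<And>\<xi>. \<xi> \<noteq> 0 \<Longrightarrow> norm (g \<xi>) \<le> C * norm \<xi> powr (- p)" and C: "0 \<le> C"
    and p: "0 < p" and c: "0 < c" and r: "1 < r" and x: "x \<noteq> 0"
    and z: "z 0 = x" "\<And>n. c * r ^ n * norm x \<le> norm (z n)"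
    and w: "\<And>n. c * r ^ n * norm x \<le> norm (w n)"
    and step: "\<And>n. norm (f (z n)) \<le> norm (g (w n)) + norm (f (z (Suc n)))"
  shows "norm (f x) \<le> C * c powr (- p) / (1 - r powr (- p)) * norm x powr (- p)"
proof -
  have pos: "0 < c * r ^ n * norm x" for n
    using c r x by simp
  have q: "0 \<le> r powr (- p)" "r powr (- p) < 1"
    using r p by (auto simp: powr_minus inverse_less_1_iff)
  have bound: "norm (g (w n)) \<le> (C * c powr (- p) * norm x powr (- p)) * (r powr (- p)) ^ n" for n
  proof -
    have "norm (w n) powr (- p) \<le> (c * r ^ n * norm x) powr (- p)"
      using w[of n] pos[of n] p by (intro powr_mono2') auto
    also have "\<dots> = c powr (- p) * norm x powr (- p) * (r powr (- p)) ^ n"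
      using c r x by (simp add: powr_mult powr_powr mult_ac flip: powr_realpow)
    finally have "C * norm (w n) powr (- p) \<le> C * (c powr (- p) * norm x powr (- p) * (r powr (- p)) ^ n)"
      using C by (rule mult_left_mono)
    moreover have "w n \<noteq> 0"
      using w[of n] pos[of n] by auto
    ultimately show ?thesis
      using g[of "w n"] by (simp add: mult_ac)
  qed
  have "filterlim (\<lambda>n. r ^ n) at_top sequentially"
    using filterlim_realpow_sequentially_gt1[of r] r
    by (simp add: filterlim_at_infinity_conv_norm_at_top norm_power)
  then have "filterlim (\<lambda>n. c * norm x * r ^ n) at_top sequentially"
    using c r x
    by (intro filterlim_tendsto_pos_mult_at_top[OF tendsto_const]) simp_all
  then have "filterlim (\<lambda>n. norm (z n)) at_top sequentially"
    by (rule filterlim_at_top_mono) (use z(2) in \<open>simp add: mult_ac\<close>)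
  then have "filterlim z at_infinity sequentially"
    by (simp add: filterlim_at_infinity_conv_norm_at_top)
  then have "(\<lambda>n. norm (f (z n))) \<longlonglongrightarrow> 0"
    by (intro tendsto_norm_zero filterlim_compose[OF lim])
  then have "norm (f (z 0)) \<le> (C * c powr (- p) * norm x powr (- p)) / (1 - r powr (- p))"
    using bound step q by (intro geometric_telescope) (smt (verit))+
  then show ?thesis
    using z(1) by (simp add: mult_ac)
qed

text \<open>With g = f + f o B, either summand can be solved for: f = g - f o B is iterated along
  forward orbits, f o B = g - f along backward ones.\<close>

lemma decay_from_sum_along_map:
  fixes f :: "'a::real_normed_vector \<Rightarrow> complex" and B :: "'a \<Rightarrow> 'a"
  assumes lim: "(f \<longlongrightarrow> 0) at_infinity" and "surj B"
    and g: "\<And>\<xi>. \<xi> \<noteq> 0 \<Longrightarrow> norm (f \<xi> + f (B \<xi>)) \<le> C * norm \<xi> powr (- p)" and C: "0 \<le> C"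
    and p: "0 < p" and c: "0 < c" and r: "1 < r"
    and dich: "(\<forall>n. c * r ^ n * norm x \<le> norm ((B ^^ n) x))
        \<or> (\<forall>n y. (B ^^ n) y = x \<longrightarrow> c * r ^ n * norm x \<le> norm y)"
    and x: "x \<noteq> 0"
  shows "norm (f x) \<le> C * c powr (- p) / (1 - r powr (- p)) * norm x powr (- p)"
proof -
  have tri: "norm (f \<xi>) \<le> norm (f \<xi> + f (B \<xi>)) + norm (f (B \<xi>))"
      "norm (f (B \<xi>)) \<le> norm (f \<xi> + f (B \<xi>)) + norm (f \<xi>)" for \<xi>
    using norm_triangle_ineq4[of "f \<xi> + f (B \<xi>)" "f (B \<xi>)"]
      norm_triangle_ineq4[of "f \<xi> + f (B \<xi>)" "f \<xi>"] by simp_all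
  from dich show ?thesis
  proof
    assume fwd: "\<forall>n. c * r ^ n * norm x \<le> norm ((B ^^ n) x)"
    show ?thesis
      by (rule decay_along_orbit[where z = "\<lambda>n. (B ^^ n) x" and w = "\<lambda>n. (B ^^ n) x"
            and g = "\<lambda>\<xi>. f \<xi> + f (B \<xi>)"]) (use assms fwd tri in auto)
  next
    assume bwd: "\<forall>n y. (B ^^ n) y = x \<longrightarrow> c * r ^ n * norm x \<le> norm y"
    \<comment> \<open>One backward orbit, chosen by a right inverse of \<open>B\<close>; the
      dichotomy bounds all preimages, hence these.\<close>
    define z where "z n = (inv B ^^ n) x" for n
    have B_z: "B (z (Suc n)) = z n" for n
      by (simp add: z_def surj_f_inv_f[OF \<open>surj B\<close>])
    have "(B ^^ n) (z n) = x" for n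
    proof (induction n)
      case (Suc n)
      then show ?case by (simp add: funpow_swap1 B_z)
    qed (simp add: z_def)
    then have zn: "c * r ^ n * norm x \<le> norm (z n)" for n
      using bwd by blast
    \<comment> \<open>The off-by-one in \<open>w\<close> only gains a factor r > 1, which is
      dropped.\<close>
    have "c * r ^ n * norm x \<le> norm (z (Suc n))" for n
    proof -
      have "c * r ^ n * norm x \<le> c * r ^ Suc n * norm x"
        using c r by (intro mult_right_mono mult_left_mono power_increasing) auto
      then show ?thesis
        using zn[of "Suc n"] by linarith
    qed
    moreover have "z 0 = x"
      by (simp add: z_def)
    moreover have "norm (f (z n)) \<le> norm (f (z (Suc n)) + f (z n)) + norm (f (z (Suc n)))" for n
      using tri(2)[of "z (Suc n)"] by (simp add: B_z)
    ultimately show ?thesis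
      by (intro decay_along_orbit[where z = z and w = "\<lambda>n. z (Suc n)"
            and g = "\<lambda>\<xi>. f \<xi> + f (B \<xi>)"]) (use assms zn B_z in auto)
  qed
qed

section \<open>Comparison of the admissible decay exponents\<close>

theorem proposition15:
  fixes \<mu> :: "(real ^ 'd) measure" and A :: "real ^ 'd ^ 'd"
  assumes "finite_measure \<mu>" and "sets \<mu> = sets borel"
    and "(fourier_transform \<mu> \<longlongrightarrow> 0) at_infinity"
    and "invertible A"
    and "\<And>z. complex_eigenvalue A z \<Longrightarrow> norm z \<noteq> 1"
  shows "fourier_dim (add_measure \<mu> (push_forward A \<mu>)) = fourier_dim \<mu>"
proof -
  let ?f = "fourier_transform \<mu>"
  let ?B = "(*v) (transpose A)"
  have inv: "invertible (transpose A)"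
    using assms(4) by (rule transpose_invertible)
  then obtain A' where A': "transpose A ** A' = mat 1" "A' ** transpose A = mat 1"
    unfolding invertible_def by blast
  have left_inv: "A' *v (?B \<xi>) = \<xi>" for \<xi>
    by (simp only: matrix_vector_mul_assoc A' matrix_vector_mul_lid)
  have surj: "surj ?B"
    by (rule surjI[of _ "(*v) A'"]) (simp add: matrix_vector_mul_assoc A')
  have nonzero: "?B \<xi> \<noteq> 0" if "\<xi> \<noteq> 0" for \<xi>
    using that left_inv[of \<xi>] by auto
  have bounded: "bounded_linear ((*v) A')"
    by (rule matrix_vector_mul_bounded_linear)
  obtain c r where c: "0 < c" and r: "1 < r"
    and dich: "\<And>x. (\<forall>n. c * r ^ n * norm x \<le> norm ((?B ^^ n) x))
        \<or> (\<forall>n y. (?B ^^ n) y = x \<longrightarrow> c * r ^ n * norm x \<le> norm y)"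
    using hyperbolic_dichotomy[of "transpose A"] assms(5) complex_eigenvalue_transpose by blast
  \<comment> \<open>Both suprema are taken over the same set of exponents.\<close>
  have "(\<exists>C. \<forall>\<xi>. \<xi> \<noteq> 0 \<longrightarrow> norm (?f \<xi> + ?f (?B \<xi>)) \<le> C * norm \<xi> powr (- s / 2))
      \<longleftrightarrow> (\<exists>C. \<forall>\<xi>. \<xi> \<noteq> 0 \<longrightarrow> norm (?f \<xi>) \<le> C * norm \<xi> powr (- s / 2))"
    if "0 \<le> s" for s
  proof
    assume "\<exists>C. \<forall>\<xi>. \<xi> \<noteq> 0 \<longrightarrow> norm (?f \<xi> + ?f (?B \<xi>)) \<le> C * norm \<xi> powr (- s / 2)"
    then obtain C where C: "\<And>\<xi>. \<xi> \<noteq> 0 \<Longrightarrow> norm (?f \<xi> + ?f (?B \<xi>)) \<le> C * norm \<xi> powr (- s / 2)"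
      by blast
    \<comment> \<open>At a unit vector the bound reads \<open>norm _ \<le> C\<close>.\<close>
    have "0 \<le> C"
      using order_trans[OF norm_ge_zero C[of "axis undefined 1"]] by simp
    show "\<exists>C. \<forall>\<xi>. \<xi> \<noteq> 0 \<longrightarrow> norm (?f \<xi>) \<le> C * norm \<xi> powr (- s / 2)"
    proof (cases "s = 0")
      \<comment> \<open>For s = 0 the geometric ratio would be 1; the total mass of \<mu> serves as
        the bound instead.\<close>
      case True
      then show ?thesis
        using norm_fourier_transform_le[OF assms(1,2)] by auto
    next
      case False
      have "norm (?f \<xi>) \<le> C * c powr (- (s / 2)) / (1 - r powr (- (s / 2))) * norm \<xi> powr (- (s / 2))"
        if "\<xi> \<noteq> 0" for \<xi>
        by (rule decay_from_sum_along_map[OF assms(3) surj _ \<open>0 \<le> C\<close> _ c r dich that])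
          (use C False \<open>0 \<le> s\<close> in auto)
      then show ?thesis
        by (intro exI[of _ "C * c powr (- (s / 2)) / (1 - r powr (- (s / 2)))"]) simp
    qed
  next
    assume "\<exists>C. \<forall>\<xi>. \<xi> \<noteq> 0 \<longrightarrow> norm (?f \<xi>) \<le> C * norm \<xi> powr (- s / 2)"
    then obtain C where C: "\<And>\<xi>. \<xi> \<noteq> 0 \<Longrightarrow> norm (?f \<xi>) \<le> C * norm \<xi> powr (- s / 2)"
      by blast
    have "0 \<le> C"
      using order_trans[OF norm_ge_zero C[of "axis undefined 1"]] by simp
    \<comment> \<open>\<open>L\<close> bounds the inverse of \<open>?B\<close>, so
      \<open>?B \<xi>\<close> is not much shorter than \<xi> and decay at \<open>?B \<xi>\<close> is
      decay in \<xi>.\<close>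
    obtain L where L: "0 < L" "\<And>x. norm (A' *v x) \<le> norm x * L"
      using bounded_linear.pos_bounded[OF bounded] by blast
    have "norm (?f \<xi> + ?f (?B \<xi>)) \<le> (C + C * (1 / L) powr (- s / 2)) * norm \<xi> powr (- s / 2)"
      if "\<xi> \<noteq> 0" for \<xi>
    proof -
      have "norm \<xi> \<le> norm (?B \<xi>) * L"
        using L(2)[of "?B \<xi>"] unfolding left_inv .
      then have "1 / L * norm \<xi> \<le> norm (?B \<xi>)"
        using L(1) by (simp add: field_simps)
      then have "norm (?B \<xi>) powr (- s / 2) \<le> (1 / L * norm \<xi>) powr (- s / 2)"
        using that L(1) \<open>0 \<le> s\<close> by (intro powr_mono2') auto
      also have "\<dots> = (1 / L) powr (- s / 2) * norm \<xi> powr (- s / 2)"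
        by (rule powr_mult)
      finally have "C * norm (?B \<xi>) powr (- s / 2) \<le> C * ((1 / L) powr (- s / 2) * norm \<xi> powr (- s / 2))"
        using \<open>0 \<le> C\<close> by (rule mult_left_mono)
      then show ?thesis
        using norm_triangle_ineq[of "?f \<xi>" "?f (?B \<xi>)"] C[OF that] C[OF nonzero[OF that]]
        by (simp add: algebra_simps)
    qed
    then show "\<exists>C. \<forall>\<xi>. \<xi> \<noteq> 0 \<longrightarrow> norm (?f \<xi> + ?f (?B \<xi>)) \<le> C * norm \<xi> powr (- s / 2)"
      by blast
  qed
  then show ?thesis
    unfolding fourier_dim_def fourier_transform_add_push_forward[OF assms(1,2)]
    by (intro arg_cong[of _ _ Sup]) auto
qed

end
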